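(* For every automaton $\mathcal{A}=(Q,\Sigma,\delta)$, every alphabet $\Sigma_o\subseteq\Sigma$ of observable events, and all sets $Q_S,Q_{NS}\subseteq Q\times 2^Q$ of secret and nonsecret pairs, respectively, there is an automaton $\mathcal{A}'$ (equipped with a set of initial states) and a bijection between the elements of the semigroup $\mathcal{B}_{P(\mathcal{A})}$ and the states of the observer of $\mathcal{A}'$.
   Context: An automaton is a triple $\mathcal{A}=(Q,\Sigma,\delta)$ with a finite state set $Q$, a finite nonempty alphabet $\Sigma$ (events), and $\delta\colon Q\times\Sigma\to 2^Q$, extended to $2^Q\times\Sigma^*$ as usual. $P\colon\Sigma^*\to\Sigma_o^*$ is the morphism erasing all events not in $\Sigma_o$. Projected automaton: $P(\mathcal{A})$ is the automaton over $\Sigma_o$ with the same states as $\mathcal{A}$, obtained by replacing each transition $(q,a,r)$ by $(q,P(a),r)$ and eliminating $\varepsilon$-transitions (so that for $a\in\Sigma_o$ there is a transition $(q,a,r)$ in $P(\mathcal{A})$ iff $r\in\delta(q,w)$ for some $w\in\Sigma^*$ with $P(w)=a$). Semigroup: for an $n$-state automaton, each string $w$ defines the $n\times n$ binary matrix $(w_{ij})$ with $w_{ij}=1$ iff $j\in\delta(i,w)$ (the empty string defines the identity matrix). $\mathcal{B}_{\mathcal{A}}$ is the semigroup, under boolean matrix multiplication (addition replaced by maximum), of all matrices defined by strings, i.e., of all finite products of the matrices of the events. $\mathcal{B}_{P(\mathcal{A})}$ is this semigroup for the automaton $P(\mathcal{A})$ over $\Sigma_o$. Observer: for an automaton with a set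 $I$ of initial states, the observer is the reachable part of the deterministic automaton constructed from its projected automaton by the standard subset construction, started in $I$; its states are subsets of the state set (possibly including the empty set). *)

theory Defs
  imports "HOL-Algebra.Group"
begin

record ('q, 'e) automaton =
  states :: "'q set"
  alphabet :: "'e set"
  trans_fun :: "'q \<Rightarrow> 'e \<Rightarrow> 'q set"

definition automaton :: "('q, 'e) automaton \<Rightarrow> bool" where
  "automaton A \<longleftrightarrow>
     finite (states A) \<and> finite (alphabet A) \<and> alphabet A \<noteq> {} \<and>
     (\<forall>q\<in>states A. \<forall>a\<in>alphabet A. trans_fun A q a \<subseteq> states A)"

primrec run :: "('q, 'e) automaton \<Rightarrow> 'q set \<Rightarrow> 'e list \<Rightarrow> 'q set" where
  "run A X [] = X"
| "run A X (a # w) = run A (\<Union>q\<in>X. trans_fun A q a) w"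

definition erase :: "'e set \<Rightarrow> 'e list \<Rightarrow> 'e list" where
  "erase So w = filter (\<lambda>a. a \<in> So) w"

definition projected :: "('q, 'e) automaton \<Rightarrow> 'e set \<Rightarrow> ('q, 'e) automaton" where
  "projected A So =
     \<lparr> states = states A,
       alphabet = So,
       trans_fun = (\<lambda>q a. {r. \<exists>w\<in>lists (alphabet A). erase So w = [a] \<and> r \<in> run A {q} w}) \<rparr>"

text \<open>
  Matrices are indexed by the state set itself; entries outside of \<open>Q \<times> Q\<close> are fixed to 0,
  so that equality of functions is equality of \<open>Q \<times> Q\<close> matrices.
\<close>

type_synonym 'q matrix = "'q \<Rightarrow> 'q \<Rightarrow> nat"

definition bool_mult :: "'q set \<Rightarrow> 'q matrix \<Rightarrow> 'q matrix \<Rightarrow> 'q matrix" where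
  "bool_mult Q M N =
     (\<lambda>i j. if i \<in> Q \<and> j \<in> Q then Max ((\<lambda>k. M i k * N k j) ` Q) else 0)"

definition ident_matrix :: "'q set \<Rightarrow> 'q matrix" where
  "ident_matrix Q = (\<lambda>i j. if i \<in> Q \<and> j \<in> Q \<and> i = j then 1 else 0)"

definition word_matrix :: "('q, 'e) automaton \<Rightarrow> 'e list \<Rightarrow> 'q matrix" where
  "word_matrix A w =
     (\<lambda>i j. if i \<in> states A \<and> j \<in> states A \<and> j \<in> run A {i} w then 1 else 0)"

definition matrix_semigroup :: "('q, 'e) automaton \<Rightarrow> 'q matrix monoid" where
  "matrix_semigroup A =
     \<lparr> carrier = word_matrix A ` lists (alphabet A),
       mult = bool_mult (states A),
       one = ident_matrix (states A) \<rparr>"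

record ('s, 'e) det_automaton =
  dstates :: "'s set"
  dalphabet :: "'e set"
  dtrans :: "'s \<Rightarrow> 'e \<Rightarrow> 's"
  dinit :: "'s"

definition subset_construction ::
    "('q, 'e) automaton \<Rightarrow> 'q set \<Rightarrow> ('q set, 'e) det_automaton" where
  "subset_construction A I =
     \<lparr> dstates = Pow (states A),
       dalphabet = alphabet A,
       dtrans = (\<lambda>X a. \<Union>q\<in>X. trans_fun A q a),
       dinit = I \<rparr>"

inductive_set reachable :: "('s, 'e) det_automaton \<Rightarrow> 's set" for D where
  init: "dinit D \<in> reachable D"
| step: "s \<in> reachable D \<Longrightarrow> a \<in> dalphabet D \<Longrightarrow> dtrans D s a \<in> reachable D"

definition reachable_part :: "('s, 'e) det_automaton \<Rightarrow> ('s, 'e) det_automaton" where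
  "reachable_part D = D \<lparr> dstates := dstates D \<inter> reachable D \<rparr>"

definition observer ::
    "('q, 'e) automaton \<Rightarrow> 'e set \<Rightarrow> 'q set \<Rightarrow> ('q set, 'e) det_automaton" where
  "observer A So I = reachable_part (subset_construction (projected A So) I)"

text \<open>
  If the transition function stays within the state set (as it does for \<open>projected A So\<close>, which
  need not satisfy \<open>automaton\<close> since \<open>So\<close> may be empty), the matrices of strings are exactly the
  finite products of the matrices of events, and they form a monoid.
\<close>

lemma run_append: "run A X (u @ v) = run A (run A X u) v"
  by (induction u arbitrary: X) auto

lemma run_Union: "run A X w = (\<Union>q\<in>X. run A {q} w)"
proof (induction w arbitrary: X)
  case (Cons a w)
  have "run A X (a # w) = (\<Union>p\<in>(\<Union>q\<in>X. trans_fun A q a). run A {p} w)"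
    unfolding run.simps by (rule Cons.IH)
  moreover have "run A {q} (a # w) = (\<Union>p\<in>trans_fun A q a. run A {p} w)" for q
    using Cons.IH[of "trans_fun A q a"] by simp
  ultimately show ?case by simp
qed simp

lemma run_closed:
  assumes "\<And>q a. q \<in> states A \<Longrightarrow> a \<in> alphabet A \<Longrightarrow> trans_fun A q a \<subseteq> states A"
    and "X \<subseteq> states A" and "w \<in> lists (alphabet A)"
  shows "run A X w \<subseteq> states A"
  using assms(2,3)
proof (induction w arbitrary: X)
  case (Cons a w)
  have "trans_fun A q a \<subseteq> states A" if "q \<in> X" for q
    by (rule assms(1)) (use Cons.prems that in auto)
  then have "(\<Union>q\<in>X. trans_fun A q a) \<subseteq> states A" by (rule UN_least)
  then show ?case using Cons.IH Cons.prems(2) by simp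
qed simp

lemma word_matrix_Nil: "word_matrix A [] = ident_matrix (states A)"
  by (auto simp: word_matrix_def ident_matrix_def fun_eq_iff)

lemma word_matrix_append:
  assumes fin: "finite (states A)"
    and closed: "\<And>q a. q \<in> states A \<Longrightarrow> a \<in> alphabet A \<Longrightarrow> trans_fun A q a \<subseteq> states A"
    and u: "u \<in> lists (alphabet A)"
  shows "word_matrix A (u @ v) = bool_mult (states A) (word_matrix A u) (word_matrix A v)"
proof (intro ext)
  fix i j
  let ?Q = "states A"
  let ?S = "(\<lambda>k. word_matrix A u i k * word_matrix A v k j) ` ?Q"
  show "word_matrix A (u @ v) i j = bool_mult ?Q (word_matrix A u) (word_matrix A v) i j"
  proof (cases "i \<in> ?Q \<and> j \<in> ?Q")
    case True
    have sub: "run A {i} u \<subseteq> ?Q" using run_closed[OF closed _ u, of "{i}"] True by simp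
    have iff: "j \<in> run A {i} (u @ v) \<longleftrightarrow> (\<exists>k\<in>?Q. k \<in> run A {i} u \<and> j \<in> run A {k} v)"
      unfolding run_append run_Union[of A "run A {i} u" v] using sub by blast
    have S01: "?S \<subseteq> {0, 1}" by (auto simp: word_matrix_def split: if_split_asm)
    have "1 \<in> ?S \<longleftrightarrow> j \<in> run A {i} (u @ v)"
      unfolding iff image_iff using True
      by (intro bex_cong refl) (auto simp: word_matrix_def split: if_split_asm)
    moreover have "Max ?S = (if 1 \<in> ?S then 1 else 0)"
    proof (cases "1 \<in> ?S")
      case True
      have "Max ?S = 1"
      proof (rule Max_eqI)
        show "finite ?S" using fin by (rule finite_imageI)
        show "y \<le> 1" if "y \<in> ?S" for y using subsetD[OF S01 that] by auto
      qed (rule True)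
      with True show ?thesis by simp
    next
      case False
      have "Max ?S = 0"
      proof (rule Max_eqI)
        show "finite ?S" using fin by (rule finite_imageI)
        show "y \<le> 0" if "y \<in> ?S" for y using subsetD[OF S01 that] that False by auto
        have "?S \<noteq> {}" using \<open>i \<in> ?Q \<and> j \<in> ?Q\<close> by blast
        then obtain y where "y \<in> ?S" by blast
        then show "0 \<in> ?S" using subsetD[OF S01 \<open>y \<in> ?S\<close>] False by auto
      qed
      with False show ?thesis by simp
    qed
    ultimately show ?thesis using True by (simp add: bool_mult_def) (simp add: word_matrix_def)
  qed (auto simp: word_matrix_def bool_mult_def)
qed

lemma word_matrix_eq_product:
  assumes "finite (states A)"
    and "\<And>q a. q \<in> states A \<Longrightarrow> a \<in> alphabet A \<Longrightarrow> trans_fun A q a \<subseteq> states A"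
    and "w \<in> lists (alphabet A)"
  shows "word_matrix A w =
    foldr (bool_mult (states A)) (map (\<lambda>a. word_matrix A [a]) w) (ident_matrix (states A))"
  using assms(3)
proof (induction w)
  case (Cons a w)
  then show ?case using word_matrix_append[OF assms(1,2), of "[a]" w] by simp
qed (simp add: word_matrix_Nil)

lemma monoid_matrix_semigroup:
  assumes "finite (states A)"
    and "\<And>q a. q \<in> states A \<Longrightarrow> a \<in> alphabet A \<Longrightarrow> trans_fun A q a \<subseteq> states A"
  shows "monoid (matrix_semigroup A)"
proof -
  let ?L = "lists (alphabet A)"
  let ?W = "word_matrix A"
  have mult: "bool_mult (states A) (?W u) (?W v) = ?W (u @ v)" if "u \<in> ?L" for u v
    using word_matrix_append[OF assms that, of v] by simp
  show ?thesis
  proof (unfold_locales, unfold matrix_semigroup_def monoid.simps partial_object.simps)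
    fix x y z assume "x \<in> ?W ` ?L" "y \<in> ?W ` ?L" "z \<in> ?W ` ?L"
    then obtain u v w where uvw: "x = ?W u" "u \<in> ?L" "y = ?W v" "v \<in> ?L" "z = ?W w" "w \<in> ?L"
      by blast
    show "bool_mult (states A) x y \<in> ?W ` ?L"
      unfolding uvw mult[OF uvw(2)] using uvw(2,4) by (intro imageI) simp
    have "u @ v \<in> ?L" using uvw(2,4) by simp
    then show "bool_mult (states A) (bool_mult (states A) x y) z =
        bool_mult (states A) x (bool_mult (states A) y z)"
      using uvw by (simp only: mult append_assoc)
  next
    show "ident_matrix (states A) \<in> ?W ` ?L"
      unfolding word_matrix_Nil[symmetric] by (intro imageI) simp
  next
    fix x assume "x \<in> ?W ` ?L"
    then obtain u where u: "x = ?W u" "u \<in> ?L" by blast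
    show "bool_mult (states A) (ident_matrix (states A)) x = x"
      using mult[of "[]" u] by (simp add: u word_matrix_Nil)
    show "bool_mult (states A) x (ident_matrix (states A)) = x"
      using mult[OF u(2), of "[]"] by (simp add: u word_matrix_Nil)
  qed
qed

lemma projected_closed:
  assumes "automaton A" and "q \<in> states (projected A So)"
  shows "trans_fun (projected A So) q a \<subseteq> states (projected A So)"
proof
  fix r assume "r \<in> trans_fun (projected A So) q a"
  then obtain w where "w \<in> lists (alphabet A)" "r \<in> run A {q} w"
    unfolding projected_def by auto
  moreover have "run A {q} w \<subseteq> states A"
  proof (rule run_closed)
    show "trans_fun A p b \<subseteq> states A" if "p \<in> states A" "b \<in> alphabet A" for p b
      using assms(1) that unfolding automaton_def by blast
    show "{q} \<subseteq> states A" using assms(2) by (simp add: projected_def)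
  qed fact
  ultimately show "r \<in> states (projected A So)" by (auto simp: projected_def)
qed

end

(* The idea: let A' consist of |Q| disjoint copies of A, one for each row of the matrices; state
   (i, j) is state j of copy i, and the initial states are the diagonal pairs (i, i). After
   observing w, the observer of A' is in the set of all (i, j) with w_ij = 1, so its states encode
   exactly the elements of the semigroup of P(A). *)
theory Submission
  imports Defs
begin

text \<open>A map that commutes with every single transition commutes with runs, since images
  distribute over unions. Closure keeps each intermediate set inside \<open>states B\<close>, where
  \<open>h\<close> is known to commute.\<close>

lemma run_image:
  assumes closed: "\<And>q a. q \<in> states B \<Longrightarrow> a \<in> alphabet B \<Longrightarrow> trans_fun B q a \<subseteq> states B"
    and h: "\<And>q a. q \<in> states B \<Longrightarrow> a \<in> alphabet B \<Longrightarrow>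
              trans_fun C (h q) a = h ` trans_fun B q a"
    and "X \<subseteq> states B" and "w \<in> lists (alphabet B)"
  shows "run C (h ` X) w = h ` run B X w"
  using assms(3,4)
proof (induction w arbitrary: X)
  case (Cons a w)
  have a: "a \<in> alphabet B" using Cons.prems(2) by simp
  have "(\<Union>q\<in>h ` X. trans_fun C q a) = h ` (\<Union>q\<in>X. trans_fun B q a)"
    using h[OF _ a] Cons.prems(1) by (simp add: image_UN subset_iff)
  moreover have "(\<Union>q\<in>X. trans_fun B q a) \<subseteq> states B"
    using closed[OF _ a] Cons.prems(1) by blast
  ultimately show ?case using Cons.IH Cons.prems(2) by simp
qed simp

text \<open>A projected transition collects runs over all words with a given erasure, and
  \<open>run_image\<close> handles each such word, so commutation passes to the projections.\<close>

lemma trans_fun_projected_image: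
  assumes closed: "\<And>q a. q \<in> states B \<Longrightarrow> a \<in> alphabet B \<Longrightarrow> trans_fun B q a \<subseteq> states B"
    and h: "\<And>q a. q \<in> states B \<Longrightarrow> a \<in> alphabet B \<Longrightarrow>
              trans_fun C (h q) a = h ` trans_fun B q a"
    and alph: "alphabet C = alphabet B"
    and q: "q \<in> states B"
  shows "trans_fun (projected C So) (h q) a = h ` trans_fun (projected B So) q a"
proof -
  have "run C {h q} w = h ` run B {q} w" if "w \<in> lists (alphabet B)" for w
    using run_image[of B C h "{q}" w, OF closed h _ that] q by simp
  then show ?thesis using alph by (auto simp: projected_def)
qed

lemma reachable_subset_construction:
  "reachable (subset_construction B I) = run B I ` lists (alphabet B)"
proof
  show "reachable (subset_construction B I) \<subseteq> run B I ` lists (alphabet B)"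
  proof
    fix X assume "X \<in> reachable (subset_construction B I)"
    then show "X \<in> run B I ` lists (alphabet B)"
    proof induction
      case init
      show ?case by (rule image_eqI[of _ _ "[]"]) (simp_all add: subset_construction_def)
    next
      case (step X a)
      then obtain w where "X = run B I w" "w \<in> lists (alphabet B)" by blast
      with step.hyps show ?case
        by (intro image_eqI[of _ _ "w @ [a]"]) (simp_all add: subset_construction_def run_append)
    qed
  qed
next
  have "run B I w \<in> reachable (subset_construction B I)" if "w \<in> lists (alphabet B)" for w
    using that
  \<comment> \<open>\<open>reachable\<close> extends a word at its right end, while
    \<open>run\<close> recurses from the left.\<close>
  proof (induction w rule: rev_induct)
    case Nil
    show ?case using reachable.init[of "subset_construction B I"]
      by (simp add: subset_construction_def)
  next
    case (snoc a w)
    then show ?case using reachable.step[of "run B I w" "subset_construction B I" a]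
      by (simp add: subset_construction_def run_append)
  qed
  then show "run B I ` lists (alphabet B) \<subseteq> reachable (subset_construction B I)" by blast
qed

lemma dstates_observer:
  assumes "automaton B" and "I \<subseteq> states B"
  shows "dstates (observer B So I) = run (projected B So) I ` lists So"
proof -
  have alph: "alphabet (projected B So) = So" and st: "states (projected B So) = states B"
    by (simp_all add: projected_def)
  have "run (projected B So) I w \<subseteq> states B" if "w \<in> lists So" for w
    using run_closed[of "projected B So" I w, OF projected_closed[OF assms(1)]] assms(2) that
    by (simp add: alph st)
  \<comment> \<open>The intersection with \<open>Pow (states B)\<close> removes nothing, because
    runs from \<open>I\<close> stay in the state set.\<close>
  moreover have "dstates (observer B So I) = Pow (states B) \<inter> run (projected B So) I ` lists So"
    using reachable_subset_construction[of "projected B So" I]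
    by (simp add: observer_def reachable_part_def alph) (simp add: subset_construction_def st)
  ultimately show ?thesis by blast
qed

text \<open>The tag \<open>p\<close> of the copy never changes; only the second component moves.
  \<open>g\<close> encodes pairs as numbers so that the new state type is fixed in advance, and the
  equation \<open>g (p, q) = n\<close> decodes a state.\<close>

definition copies :: "('q \<times> 'q \<Rightarrow> nat) \<Rightarrow> ('q, 'e) automaton \<Rightarrow> (nat, 'e) automaton" where
  "copies g A =
     \<lparr> states = g ` (states A \<times> states A),
       alphabet = alphabet A,
       trans_fun = (\<lambda>n a. {g (p, r) | p q r.
         p \<in> states A \<and> q \<in> states A \<and> g (p, q) = n \<and> r \<in> trans_fun A q a}) \<rparr>"

lemma automaton_copies: "automaton A \<Longrightarrow> automaton (copies g A)"
  unfolding automaton_def copies_def by (auto 4 3)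

text \<open>Injectivity of \<open>g\<close> makes decoding unique, so the copies do not interact and
  copy \<open>p\<close> evolves as \<open>A\<close> does, via the embedding of \<open>r\<close> as
  \<open>g (p, r)\<close>.\<close>

lemma run_projected_copies:
  assumes A: "automaton A" and So: "w \<in> lists So"
    and g: "inj_on g (states A \<times> states A)" and p: "p \<in> states A" and q: "q \<in> states A"
  shows "run (projected (copies g A) So) {g (p, q)} w
           = (\<lambda>r. g (p, r)) ` run (projected A So) {q} w"
proof -
  have closed: "trans_fun A q a \<subseteq> states A" if "q \<in> states A" "a \<in> alphabet A" for q a
    using A that unfolding automaton_def by blast
  have "trans_fun (copies g A) (g (p, q)) a = (\<lambda>r. g (p, r)) ` trans_fun A q a"
    if "q \<in> states A" for q a
    using that p by (auto simp: copies_def inj_on_eq_iff[OF g])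
  then have "trans_fun (projected (copies g A) So) (g (p, q)) a
      = (\<lambda>r. g (p, r)) ` trans_fun (projected A So) q a" if "q \<in> states A" for q a
    by (intro trans_fun_projected_image closed that) (auto simp: copies_def)
  \<comment> \<open>The start singleton is written as an image so that \<open>run_image\<close>
    applies.\<close>
  then have "run (projected (copies g A) So) ((\<lambda>r. g (p, r)) ` {q}) w
      = (\<lambda>r. g (p, r)) ` run (projected A So) {q} w"
    by (intro run_image projected_closed[OF A]) (use q So in \<open>simp_all add: projected_def\<close>)
  then show ?thesis by simp
qed

text \<open>A run from a set is the union of the runs from its elements, and the run from
  \<open>g (i, i)\<close> yields row \<open>i\<close> of the matrix.\<close>

lemma run_projected_copies_diagonal:
  assumes A: "automaton A" and w: "w \<in> lists So"
    and g: "inj_on g (states A \<times> states A)"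
  shows "run (projected (copies g A) So) ((\<lambda>q. g (q, q)) ` states A) w
           = g ` {(i, j) \<in> states A \<times> states A. word_matrix (projected A So) w i j = 1}"
    (is "_ = g ` ?R")
proof -
  have "run (projected A So) {i} w \<subseteq> states A" if "i \<in> states A" for i
    using run_closed[of "projected A So" "{i}" w, OF projected_closed[OF A]] that w
    by (simp add: projected_def)
  then have R: "?R = (SIGMA i:states A. run (projected A So) {i} w)"
    by (auto simp: word_matrix_def projected_def split: if_split_asm)
  have "run (projected (copies g A) So) ((\<lambda>q. g (q, q)) ` states A) w
      = (\<Union>i\<in>states A. run (projected (copies g A) So) {g (i, i)} w)"
    by (subst run_Union) simp
  also have "\<dots> = (\<Union>i\<in>states A. (\<lambda>r. g (i, r)) ` run (projected A So) {i} w)"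
    by (simp add: run_projected_copies[OF A w g])
  finally show ?thesis unfolding R by (auto simp: image_iff)
qed

text \<open>Entries are 0 or 1 and vanish outside the state set, so the positions of the ones
  determine the matrix.\<close>

lemma word_matrix_eqI:
  assumes "{(i, j) \<in> states A \<times> states A. word_matrix A u i j = 1}
             = {(i, j) \<in> states A \<times> states A. word_matrix A v i j = 1}"
  shows "word_matrix A u = word_matrix A v"
proof (intro ext)
  fix i j
  show "word_matrix A u i j = word_matrix A v i j"
    using arg_cong[OF assms, of "\<lambda>S. (i, j) \<in> S"]
    by (auto simp: word_matrix_def split: if_splits)
qed

theorem lemma4:
  fixes A :: "('q, 'e) automaton"
    and So :: "'e set"
    and QS QNS :: "('q \<times> 'q set) set"
  assumes "automaton A"
    and "So \<subseteq> alphabet A"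
    and "QS \<subseteq> states A \<times> Pow (states A)"
    and "QNS \<subseteq> states A \<times> Pow (states A)"
  shows "\<exists>(A' :: (nat, 'e) automaton) I'.
           automaton A' \<and> alphabet A' = alphabet A \<and> I' \<subseteq> states A' \<and>
           (\<exists>f. bij_betw f (carrier (matrix_semigroup (projected A So)))
                           (dstates (observer A' So I')))"
proof -
  let ?Q = "states A"
  have "finite (?Q \<times> ?Q)" using assms(1) by (simp add: automaton_def)
  then obtain g :: "'q \<times> 'q \<Rightarrow> nat" where g: "inj_on g (?Q \<times> ?Q)"
    using finite_imp_inj_to_nat_seg by blast
  define I where "I = (\<lambda>q. g (q, q)) ` ?Q"
  \<comment> \<open>A matrix is sent to the encoded set of positions of its ones.\<close>
  define f where "f M = g ` {(i, j) \<in> ?Q \<times> ?Q. M i j = 1}" for M :: "'q matrix"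
  have B: "automaton (copies g A)" using assms(1) by (rule automaton_copies)
  have I: "I \<subseteq> states (copies g A)" by (auto simp: I_def copies_def)
  have carrier: "carrier (matrix_semigroup (projected A So))
      = word_matrix (projected A So) ` lists So"
    by (simp add: matrix_semigroup_def) (simp add: projected_def)
  have "bij_betw f (carrier (matrix_semigroup (projected A So)))
          (dstates (observer (copies g A) So I))"
    unfolding bij_betw_def
  proof
    show "inj_on f (carrier (matrix_semigroup (projected A So)))"
    proof (rule inj_onI, unfold carrier, elim imageE, hypsubst)
      fix u v
      assume "f (word_matrix (projected A So) u) = f (word_matrix (projected A So) v)"
      then have "{(i, j) \<in> ?Q \<times> ?Q. word_matrix (projected A So) u i j = 1}
          = {(i, j) \<in> ?Q \<times> ?Q. word_matrix (projected A So) v i j = 1}"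
        \<comment> \<open>Both position sets lie in the domain on which \<open>g\<close> is
          injective, so \<open>g\<close> cancels.\<close>
        unfolding f_def by (subst (asm) inj_on_image_eq_iff[OF g]) auto
      then show "word_matrix (projected A So) u = word_matrix (projected A So) v"
        by (intro word_matrix_eqI) (simp add: projected_def)
    qed
    show "f ` carrier (matrix_semigroup (projected A So)) = dstates (observer (copies g A) So I)"
      \<comment> \<open>Both sides are now images of \<open>lists So\<close>, and they agree word by
        word.\<close>
      unfolding carrier dstates_observer[OF B I] image_image
      by (intro image_cong refl)
        (simp add: f_def I_def run_projected_copies_diagonal[OF assms(1) _ g])
  qed
  moreover have "alphabet (copies g A) = alphabet A" by (simp add: copies_def)
  ultimately show ?thesis using B I by blast
qed

end
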